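(* For $\epsilon>0$, $N\in\mathbb{N}_+$ and a positive integer $\tau$ consider the evaluation and Jacobian oracle-complexity upper bounds $$E(\epsilon,N,\tau)=\widetilde{\Theta} \left( N+\tau^5 + N\epsilon^{-1} \tau^{-1} + \epsilon^{-1} \tau^4 \right),\qquad J(\epsilon,N,\tau)=\widetilde{\Theta} \left( N+\tau^3+ N\epsilon^{-1} \tau^{-1} + \epsilon^{-1} \tau^2 \right).$$ (i) The minimal asymptotic rate of $E$ with respect to the choice of $\tau$ (as a function of $\epsilon,N$) is $\widetilde{\Theta} \left( N + N^{4/5} \epsilon^{-1} \right)$, achieved by setting $\tau = \Theta \left(N^{1/5} \right)$. In this case, $J$ is also $\widetilde{\Theta} \left( N + N^{4/5} \epsilon^{-1} \right)$. (ii) The minimal asymptotic rate of $J$ with respect to the choice of $\tau$ is $\widetilde{\Theta} \left( N + N^{2/3} \epsilon^{-1} \right)$, achieved by setting $\tau = \Theta \left( N^{1/3} \right)$. In this case, $E$ becomes $\widetilde{\Theta} \left( N^{5/3} + N^{4/3} \epsilon^{-1} \right)$.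
   Context: Asymptotic notation is with respect to $\epsilon\to0$ and $N\to\infty$, and $\widetilde\Theta$ omits multiplicative logarithmic terms in $\epsilon$. Meaning of the quantities: for minimizing $f(g(x))+h(x)$ with $g=\frac1N\sum_{j=1}^N g_j$ by the variance-reduced inexact prox-linear method whose inner loops all have length $\tau$, $E$ and $J$ are upper bounds on the number of evaluations of $g_j$ and of Jacobians $g'_j$ used to make the average of $\|\mathcal{G}_M\|_2^2$ over the iterates at most $\epsilon$ with high probability, when $g$ and $g'$ are computed exactly at the start $x_0$ of each inner loop and, at the $i$-th inner iterate $x_i$, $i>0$, are estimated by $\widetilde g_i=\frac1a\sum_{j\in\mathcal{A}_i}(g_j(x_i)-g_j(x_0)-g'_j(x_0)(x_i-x_0))+g(x_0)+g'(x_0)(x_i-x_0)$, $\widetilde J_i=\frac1b\sum_{j\in\mathcal{B}_i}(g'_j(x_i)-g'_j(x_0))+g'(x_0)$ with batches $\mathcal{A}_i,\mathcal{B}_i$ of sizes $a,b$ sampled uniformly with replacement from $\{1,\dots,N\}$. The claim concerns only the two displayed expressions. *)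

theory Defs
  imports Complex_Main "HOL-Library.Landau_Symbols"
begin

text \<open>
  Soft Landau symbols, hiding polylogarithmic factors in $1/\epsilon$. The arguments are tuples
  whose first component is $\epsilon$, e.g. $(\epsilon, N)$ or $(\epsilon, N, \tau)$; factors
  logarithmic in the other components are not hidden.
\<close>

definition soft_bigo :: "(real \<times> 'a) filter \<Rightarrow> (real \<times> 'a \<Rightarrow> real) \<Rightarrow> (real \<times> 'a \<Rightarrow> real) set" where
  "soft_bigo F g = {f. \<exists>k::nat. f \<in> O[F](\<lambda>x. g x * ln (1 / fst x) ^ k)}"

definition soft_bigomega :: "(real \<times> 'a) filter \<Rightarrow> (real \<times> 'a \<Rightarrow> real) \<Rightarrow> (real \<times> 'a \<Rightarrow> real) set" where
  "soft_bigomega F g = {f. \<exists>k::nat. f \<in> \<Omega>[F](\<lambda>x. g x / ln (1 / fst x) ^ k)}"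

definition soft_bigtheta :: "(real \<times> 'a) filter \<Rightarrow> (real \<times> 'a \<Rightarrow> real) \<Rightarrow> (real \<times> 'a \<Rightarrow> real) set" where
  "soft_bigtheta F g = soft_bigo F g \<inter> soft_bigomega F g"

text \<open>$\epsilon \to 0^+$ and $N \to \infty$, jointly and independently of each other.\<close>

definition eps_N :: "(real \<times> nat) filter" where
  "eps_N = at_right 0 \<times>\<^sub>F at_top"

text \<open>
  The same limit, uniformly in the positive integer $\tau$: a property holds eventually if it
  holds for all sufficiently small $\epsilon$, all sufficiently large $N$, and every
  $\tau \ge 1$.
\<close>

definition eps_N_unif :: "(real \<times> nat \<times> nat) filter" where
  "eps_N_unif = at_right 0 \<times>\<^sub>F (at_top \<times>\<^sub>F principal {1..})"

definition choices :: "(real \<Rightarrow> nat \<Rightarrow> nat) set" where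
  "choices = {\<tau>. \<forall>\<epsilon>>0. \<forall>N>0. \<tau> \<epsilon> N > 0}"

definition rate_of :: "(real \<Rightarrow> nat \<Rightarrow> nat \<Rightarrow> real) \<Rightarrow> (real \<Rightarrow> nat \<Rightarrow> nat) \<Rightarrow> real \<times> nat \<Rightarrow> real" where
  "rate_of C \<tau> = (\<lambda>(\<epsilon>, N). C \<epsilon> N (\<tau> \<epsilon> N))"

text \<open>
  \<open>R\<close> is the least rate of \<open>C\<close>, up to polylogarithmic factors in $1/\epsilon$, over all ways
  of choosing $\tau$ as a function of $\epsilon$ and $N$.
\<close>

definition is_minimal_rate :: "(real \<Rightarrow> nat \<Rightarrow> nat \<Rightarrow> real) \<Rightarrow> (real \<times> nat \<Rightarrow> real) \<Rightarrow> bool" where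
  "is_minimal_rate C R \<longleftrightarrow>
     (\<forall>\<tau>\<in>choices. rate_of C \<tau> \<in> soft_bigomega eps_N R) \<and>
     (\<exists>\<tau>\<in>choices. rate_of C \<tau> \<in> soft_bigtheta eps_N R)"

definition choices_of_order :: "(nat \<Rightarrow> real) \<Rightarrow> (real \<Rightarrow> nat \<Rightarrow> nat) set" where
  "choices_of_order s = {\<tau> \<in> choices. (\<lambda>(\<epsilon>, N). real (\<tau> \<epsilon> N)) \<in> \<Theta>[eps_N](\<lambda>(\<epsilon>, N). s N)}"

end

theory Submission imports Defs begin

text \<open>
  Both bounds have the shape $N + \tau^{p+1} + N \epsilon^{-1} \tau^{-1} + \epsilon^{-1} \tau^p$,
  with $p = 4$ for $E$ and $p = 2$ for $J$. The last two terms balance at $\tau = N^{1/(p+1)}$: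
  below this threshold the term $N \epsilon^{-1} \tau^{-1}$ alone is at least
  $N^{p/(p+1)} \epsilon^{-1}$, above it the term $\epsilon^{-1} \tau^p$ is, so no choice of
  $\tau$ beats $N + N^{p/(p+1)} \epsilon^{-1}$. For $\tau = \Theta(N^q)$ the dominating powers
  of $N$ are decided by the sign of $q (p+1) - 1$.
\<close>

definition cost :: "nat \<Rightarrow> real \<times> nat \<times> nat \<Rightarrow> real" where
  "cost p = (\<lambda>(\<epsilon>, N, \<tau>). real N + real \<tau> ^ (p + 1) + real N * inverse \<epsilon> * inverse (real \<tau>)
     + inverse \<epsilon> * real \<tau> ^ p)"

section \<open>Calculus of soft and ordinary Landau symbols\<close>

lemma soft_bigomega_trans:
  assumes "f \<in> soft_bigomega F g" "g \<in> \<Omega>[F](h)"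
  shows "f \<in> soft_bigomega F h"
proof -
  obtain k where "f \<in> \<Omega>[F](\<lambda>x. g x / ln (1 / fst x) ^ k)"
    using assms(1) by (auto simp: soft_bigomega_def)
  also have "(\<lambda>x. g x / ln (1 / fst x) ^ k) \<in> \<Omega>[F](\<lambda>x. h x / ln (1 / fst x) ^ k)"
    unfolding divide_inverse using assms(2) by (rule landau_omega.big.mult_right)
  finally show ?thesis by (auto simp: soft_bigomega_def)
qed

lemma soft_bigtheta_trans:
  assumes "f \<in> soft_bigtheta F g" "g \<in> \<Theta>[F](h)"
  shows "f \<in> soft_bigtheta F h"
proof -
  obtain k where "f \<in> O[F](\<lambda>x. g x * ln (1 / fst x) ^ k)"
    using assms(1) by (auto simp: soft_bigtheta_def soft_bigo_def)
  also have "(\<lambda>x. g x * ln (1 / fst x) ^ k) \<in> O[F](\<lambda>x. h x * ln (1 / fst x) ^ k)"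
    using bigthetaD1[OF assms(2)] by (rule landau_o.big.mult_right)
  finally have "f \<in> soft_bigo F h" by (auto simp: soft_bigo_def)
  with assms show ?thesis
    by (auto simp: soft_bigtheta_def intro: soft_bigomega_trans bigthetaD2)
qed

text \<open>The hidden logarithms depend only on the first component. Since \<open>h\<close>
  preserves that component, the substitution leaves them intact and the same two exponents still
  work.\<close>

lemma soft_bigtheta_compose:
  assumes "f \<in> soft_bigtheta F g" "filterlim h F G" "\<And>x. fst (h x) = fst x"
  shows "(\<lambda>x. f (h x)) \<in> soft_bigtheta G (\<lambda>x. g (h x))"
proof -
  obtain k l where "f \<in> O[F](\<lambda>x. g x * ln (1 / fst x) ^ k)"
      "f \<in> \<Omega>[F](\<lambda>x. g x / ln (1 / fst x) ^ l)"
    using assms(1) by (auto simp: soft_bigtheta_def soft_bigo_def soft_bigomega_def)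
  from landau_o.big.compose[OF this(1) assms(2)] landau_omega.big.compose[OF this(2) assms(2)]
  show ?thesis
    by (auto simp: assms(3) soft_bigtheta_def soft_bigo_def soft_bigomega_def)
qed

text \<open>Nonnegativity rules out cancellation: each summand is bounded by the whole sum. The
  lower bound is the upper bound with the roles of \<open>f1\<close>, \<open>f2\<close> and
  \<open>g1\<close>, \<open>g2\<close> exchanged.\<close>

lemma bigtheta_add_nonneg:
  fixes f1 f2 g1 g2 :: "'a \<Rightarrow> real"
  assumes "f1 \<in> \<Theta>[F](g1)" "f2 \<in> \<Theta>[F](g2)"
    and "eventually (\<lambda>x. f1 x \<ge> 0 \<and> f2 x \<ge> 0 \<and> g1 x \<ge> 0 \<and> g2 x \<ge> 0) F"
  shows "(\<lambda>x. f1 x + f2 x) \<in> \<Theta>[F](\<lambda>x. g1 x + g2 x)"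
proof -
  have upper: "(\<lambda>x. u1 x + u2 x) \<in> O[F](\<lambda>x. v1 x + v2 x)"
    if "u1 \<in> O[F](v1)" "u2 \<in> O[F](v2)" "eventually (\<lambda>x. v1 x \<ge> 0 \<and> v2 x \<ge> 0) F"
    for u1 u2 v1 v2 :: "'a \<Rightarrow> real"
  proof (rule sum_in_bigo)
    have "v1 \<in> O[F](\<lambda>x. v1 x + v2 x)" "v2 \<in> O[F](\<lambda>x. v1 x + v2 x)"
      by (rule landau_o.big_mono, use that(3) in \<open>eventually_elim, simp\<close>)+
    then show "u1 \<in> O[F](\<lambda>x. v1 x + v2 x)" "u2 \<in> O[F](\<lambda>x. v1 x + v2 x)"
      using that(1,2) landau_o.big_trans by blast+
  qed
  show ?thesis
  proof (rule bigthetaI)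
    show "(\<lambda>x. f1 x + f2 x) \<in> O[F](\<lambda>x. g1 x + g2 x)"
      using assms by (intro upper bigthetaD1) (auto elim: eventually_mono)
    have "(\<lambda>x. g1 x + g2 x) \<in> O[F](\<lambda>x. f1 x + f2 x)"
      using assms by (intro upper bigthetaD1) (auto elim: eventually_mono simp: bigtheta_sym[of g1] bigtheta_sym[of g2])
    then show "(\<lambda>x. f1 x + f2 x) \<in> \<Omega>[F](\<lambda>x. g1 x + g2 x)"
      by (simp add: bigomega_iff_bigo)
  qed
qed

lemma bigtheta_power:
  fixes f g :: "'a \<Rightarrow> real"
  assumes "f \<in> \<Theta>[F](g)"
  shows "(\<lambda>x. f x ^ n) \<in> \<Theta>[F](\<lambda>x. g x ^ n)"
  by (intro bigthetaI landau_o.big_power landau_omega.big_power bigthetaD1[OF assms]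
      bigthetaD2[OF assms])

section \<open>The limit filters and substitution of a choice of \<tau>\<close>

lemma eventually_eps_N: "eventually (\<lambda>x. fst x > 0 \<and> snd x > 0) eps_N"
proof -
  have "eventually (\<lambda>\<epsilon>::real. \<epsilon> > 0) (at_right 0)"
    by (simp add: eventually_at_right_less)
  moreover have "eventually (\<lambda>N::nat. N > 0) at_top" by (rule eventually_gt_at_top)
  ultimately show ?thesis
    unfolding eps_N_def eventually_prod_filter by fastforce
qed

text \<open>This is where uniformity in \<tau> pays off: the third component only has to stay in
  \<open>{1..}\<close>, so \<tau> may depend on \<epsilon> and N in any way. Positivity of \<tau> is
  known for positive \<epsilon> and N, which is eventually the case.\<close>

lemma filterlim_choice:
  assumes "\<tau> \<in> choices"
  shows "filterlim (\<lambda>x. (fst x, snd x, \<tau> (fst x) (snd x))) eps_N_unif eps_N"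
  unfolding eps_N_unif_def
proof (intro filterlim_Pair)
  show "filterlim fst (at_right 0) eps_N" "filterlim snd at_top eps_N"
    by (simp_all add: eps_N_def filterlim_def filtermap_fst_prod_filter filtermap_snd_prod_filter)
  show "filterlim (\<lambda>x. \<tau> (fst x) (snd x)) (principal {1..}) eps_N"
    unfolding filterlim_principal using eventually_eps_N
    by eventually_elim (use assms in \<open>auto simp: choices_def Suc_le_eq\<close>)
qed

text \<open>Reduces every question about \<open>C\<close> along a choice to one about the explicit
  function \<open>g\<close> along that choice.\<close>

lemma rate_of_soft_bigtheta:
  assumes "(\<lambda>(\<epsilon>, N, \<tau>). C \<epsilon> N \<tau>) \<in> soft_bigtheta eps_N_unif g" "\<tau> \<in> choices"
  shows "rate_of C \<tau> \<in> soft_bigtheta eps_N (\<lambda>x. g (fst x, snd x, \<tau> (fst x) (snd x)))"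
  using soft_bigtheta_compose[OF assms(1) filterlim_choice[OF assms(2)]]
  by (simp add: rate_of_def case_prod_unfold)

section \<open>Pointwise lower bound, valid for every \<tau>\<close>

lemma cost_lower_bound:
  assumes "\<epsilon> > 0" "N > 0" "\<tau> > 0"
  shows "real N + real N powr (real p / (real p + 1)) * inverse \<epsilon> \<le> cost p (\<epsilon>, N, \<tau>)"
proof -
  define s where "s = real N powr (1 / (real p + 1))"
  have s: "s > 0" using assms by (simp add: s_def)
  have sp: "s ^ p = real N powr (real p / (real p + 1))"
    using assms by (simp add: s_def powr_power)
  have "s ^ (p + 1) = real N"
    using assms unfolding s_def by (subst powr_power) (auto simp: field_simps)
  \<comment> \<open>The competing terms \<open>N / \<tau>\<close> (decreasing in \<tau>) and
    \<open>\<tau> ^ p\<close> (nondecreasing) both take the value \<open>s ^ p\<close> at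
    \<open>\<tau> = s\<close>, so on either side of \<open>s\<close> one of them alone reaches
    it.\<close>
  then have sp': "s ^ p = real N * inverse s"
    using s by (simp add: field_simps)
  have "s ^ p \<le> real N * inverse (real \<tau>) + real \<tau> ^ p"
  proof (cases "real \<tau> \<le> s")
    case True
    then have "real N * inverse s \<le> real N * inverse (real \<tau>)"
      using assms s by (intro mult_left_mono) auto
    then show ?thesis using sp' by (simp add: add_increasing2)
  next
    case False
    then have "s ^ p \<le> real \<tau> ^ p" using s by (intro power_mono) auto
    then show ?thesis by (simp add: add_increasing)
  qed
  then have "s ^ p * inverse \<epsilon> \<le> (real N * inverse (real \<tau>) + real \<tau> ^ p) * inverse \<epsilon>"
    using assms by (intro mult_right_mono) auto
  then have "s ^ p * inverse \<epsilon> \<le> real N * inverse \<epsilon> * inverse (real \<tau>) + inverse \<epsilon> * real \<tau> ^ p"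
    by (simp add: algebra_simps)
  \<comment> \<open>Discarding this term leaves a bound with constant 1, before any limit is
    taken.\<close>
  moreover have "0 \<le> real \<tau> ^ (p + 1)" by simp
  ultimately show ?thesis unfolding cost_def sp by (simp only: prod.case)
qed

section \<open>Cost of choices of order N^q\<close>

lemma choices_of_order_powr_nonempty:
  assumes "q \<ge> 0"
  shows "choices_of_order (\<lambda>N. real N powr q) \<noteq> {}"
proof -
  define \<tau> :: "real \<Rightarrow> nat \<Rightarrow> nat" where "\<tau> = (\<lambda>\<epsilon> N. nat \<lceil>real N powr q\<rceil>)"
  have ge1: "real N powr q \<ge> 1" if "N > 0" for N :: nat
    using that assms by (simp add: ge_one_powr_ge_zero)
  \<comment> \<open>Rounding up adds less than 1, and \<open>1 \<le> N powr q\<close>, so the value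
    at most doubles.\<close>
  have bounds: "real N powr q \<le> real (\<tau> \<epsilon> N)" "real (\<tau> \<epsilon> N) \<le> 2 * real N powr q"
    if "N > 0" for \<epsilon> N
    using ge1[OF that] unfolding \<tau>_def by linarith+
  have "\<tau> \<epsilon> N > 0" if "N > 0" for \<epsilon> N
    using bounds(1)[OF that, of \<epsilon>] ge1[OF that] by linarith
  then have "\<tau> \<in> choices" by (simp add: choices_def)
  moreover have "(\<lambda>x. real (\<tau> (fst x) (snd x))) \<in> \<Theta>[eps_N](\<lambda>x. real (snd x) powr q)"
  proof (rule bigthetaI)
    show "(\<lambda>x. real (\<tau> (fst x) (snd x))) \<in> O[eps_N](\<lambda>x. real (snd x) powr q)"
      by (rule bigoI[of _ 2], use eventually_eps_N in eventually_elim) (use bounds in auto)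
    show "(\<lambda>x. real (\<tau> (fst x) (snd x))) \<in> \<Omega>[eps_N](\<lambda>x. real (snd x) powr q)"
      by (rule landau_omega.big_mono, use eventually_eps_N in eventually_elim) (use bounds in auto)
  qed
  ultimately have "\<tau> \<in> choices_of_order (\<lambda>N. real N powr q)"
    by (simp add: choices_of_order_def case_prod_unfold)
  then show ?thesis by blast
qed

text \<open>All summands are nonnegative and \<open>\<Theta>\<close> respects products, powers and
  inverses, so \<tau> can be replaced by its order term by term. The choice may vary with
  \<epsilon>, but its order depends on N alone.\<close>

lemma cost_bigtheta:
  assumes "\<tau> \<in> choices_of_order (\<lambda>N. real N powr q)"
  shows "(\<lambda>x. cost p (fst x, snd x, \<tau> (fst x) (snd x))) \<in> \<Theta>[eps_N](\<lambda>(\<epsilon>, N).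
    real N + real N powr (q * (real p + 1)) + real N powr (1 - q) * inverse \<epsilon>
      + real N powr (q * real p) * inverse \<epsilon>)"
proof -
  define t where "t = (\<lambda>x. real (\<tau> (fst x) (snd x)))"
  have t: "t \<in> \<Theta>[eps_N](\<lambda>x. real (snd x) powr q)"
    using assms by (simp add: choices_of_order_def case_prod_unfold t_def)
  have "(\<lambda>x. cost p (fst x, snd x, \<tau> (fst x) (snd x))) = (\<lambda>x. real (snd x) + t x ^ (p + 1)
      + real (snd x) * inverse (fst x) * inverse (t x) + inverse (fst x) * t x ^ p)"
    by (simp add: cost_def t_def)
  also have "\<dots> \<in> \<Theta>[eps_N](\<lambda>x. real (snd x) + (real (snd x) powr q) ^ (p + 1)
      + real (snd x) * inverse (fst x) * inverse (real (snd x) powr q)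
      + inverse (fst x) * (real (snd x) powr q) ^ p)"
    by (intro bigtheta_add_nonneg landau_theta.mult bigtheta_power bigtheta_refl
          bigtheta_inverse[THEN iffD2] t; use eventually_eps_N in eventually_elim) (simp_all add: t_def)
  also have "\<dots> = \<Theta>[eps_N](\<lambda>(\<epsilon>, N). real N + real N powr (q * (real p + 1))
      + real N powr (1 - q) * inverse \<epsilon> + real N powr (q * real p) * inverse \<epsilon>)"
    \<comment> \<open>Merging the powers, as in \<open>N / N powr q = N powr (1 - q)\<close>, uses N
      > 0, hence only an eventual equality.\<close>
    by (rule landau_theta.cong, use eventually_eps_N in eventually_elim)
      (simp add: case_prod_unfold powr_power powr_diff field_simps del: power_Suc)
  finally show ?thesis .
qed

text \<open>For N \<ge> 1 a larger exponent gives a larger power, so the terms with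
  \<open>a'\<close> and \<open>b'\<close> at most double the sum.\<close>

lemma bigtheta_of_dominated:
  assumes "a' \<le> a" "b' \<le> b"
  shows "(\<lambda>(\<epsilon>, N). real N powr a + real N powr a' + real N powr b * inverse \<epsilon>
      + real N powr b' * inverse \<epsilon>)
    \<in> \<Theta>[eps_N](\<lambda>(\<epsilon>, N). real N powr a + real N powr b * inverse \<epsilon>)" (is "?f \<in> \<Theta>[_](?g)")
proof -
  have "eventually (\<lambda>x. 0 \<le> ?g x \<and> ?g x \<le> ?f x \<and> ?f x \<le> 2 * ?g x) eps_N"
    using eventually_eps_N
  proof eventually_elim
    case (elim x)
    obtain \<epsilon> N where x: "x = (\<epsilon>, N)" by (cases x)
    have "real N powr a' \<le> real N powr a" "real N powr b' \<le> real N powr b"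
      using elim assms x by (auto intro!: powr_mono)
    moreover from this(2) have "real N powr b' * inverse \<epsilon> \<le> real N powr b * inverse \<epsilon>"
      using elim x by (intro mult_right_mono) auto
    moreover have "0 \<le> real N powr a'" "0 \<le> real N powr b' * inverse \<epsilon>"
      using elim x by auto
    \<comment> \<open>Abstracting the powers to real variables leaves pure linear
      arithmetic.\<close>
    moreover have "0 \<le> A + B \<and> A + B \<le> A + A' + B + B' \<and> A + A' + B + B' \<le> 2 * (A + B)"
      if "A' \<le> A" "B' \<le> B" "0 \<le> A'" "0 \<le> B'" for A A' B B' :: real
      using that by auto
    ultimately show ?case unfolding x prod.case by blast
  qed
  then show ?thesis
    by (intro bigthetaI bigoI[of _ 2] landau_omega.big_mono) (auto elim!: eventually_mono)
qed

text \<open>One condition settles both comparisons: \<open>q * (p + 1) \<le> 1\<close> is the same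
  as \<open>q * p \<le> 1 - q\<close>.\<close>

lemma cost_bigtheta_small:
  assumes "\<tau> \<in> choices_of_order (\<lambda>N. real N powr q)" "q * (real p + 1) \<le> 1"
  shows "(\<lambda>x. cost p (fst x, snd x, \<tau> (fst x) (snd x)))
    \<in> \<Theta>[eps_N](\<lambda>(\<epsilon>, N). real N + real N powr (1 - q) * inverse \<epsilon>)"
proof -
  have "(\<lambda>(\<epsilon>, N). real N + real N powr (q * (real p + 1)) + real N powr (1 - q) * inverse \<epsilon>
      + real N powr (q * real p) * inverse \<epsilon>)
    \<in> \<Theta>[eps_N](\<lambda>(\<epsilon>, N). real N + real N powr (1 - q) * inverse \<epsilon>)"
    using bigtheta_of_dominated[of "q * (real p + 1)" 1 "q * real p" "1 - q"] assms(2)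
    by (simp add: distrib_left)
  with cost_bigtheta[OF assms(1)] show ?thesis by (rule landau_theta.trans)
qed

text \<open>With the inequality reversed, both comparisons flip and the powers of \<tau>
  dominate.\<close>

lemma cost_bigtheta_large:
  assumes "\<tau> \<in> choices_of_order (\<lambda>N. real N powr q)" "q * (real p + 1) \<ge> 1"
  shows "(\<lambda>x. cost p (fst x, snd x, \<tau> (fst x) (snd x)))
    \<in> \<Theta>[eps_N](\<lambda>(\<epsilon>, N). real N powr (q * (real p + 1)) + real N powr (q * real p) * inverse \<epsilon>)"
proof -
  have "(\<lambda>(\<epsilon>, N). real N + real N powr (q * (real p + 1)) + real N powr (1 - q) * inverse \<epsilon>
      + real N powr (q * real p) * inverse \<epsilon>)
    \<in> \<Theta>[eps_N](\<lambda>(\<epsilon>, N). real N powr (q * (real p + 1)) + real N powr (q * real p) * inverse \<epsilon>)"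
    using bigtheta_of_dominated[of 1 "q * (real p + 1)" "1 - q" "q * real p"] assms(2)
    by (simp add: distrib_left add_ac)
  with cost_bigtheta[OF assms(1)] show ?thesis by (rule landau_theta.trans)
qed

section \<open>Minimal rates and the two concrete choices\<close>

lemma is_minimal_rate_of_cost:
  assumes C: "(\<lambda>(\<epsilon>, N, \<tau>). C \<epsilon> N \<tau>) \<in> soft_bigtheta eps_N_unif (cost p)"
  shows "is_minimal_rate C (\<lambda>(\<epsilon>, N). real N + real N powr (real p / (real p + 1)) * inverse \<epsilon>)"
  unfolding is_minimal_rate_def
proof (intro conjI ballI)
  fix \<tau> assume \<tau>: "\<tau> \<in> choices"
  have "(\<lambda>x. cost p (fst x, snd x, \<tau> (fst x) (snd x)))
      \<in> \<Omega>[eps_N](\<lambda>(\<epsilon>, N). real N + real N powr (real p / (real p + 1)) * inverse \<epsilon>)"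
  proof (rule landau_omega.big_mono, use eventually_eps_N in eventually_elim)
    case (elim x)
    then show ?case
      using cost_lower_bound[of "fst x" "snd x" "\<tau> (fst x) (snd x)" p] \<tau>
      by (auto simp: choices_def case_prod_unfold)
  qed
  with rate_of_soft_bigtheta[OF C \<tau>]
  show "rate_of C \<tau> \<in> soft_bigomega eps_N
      (\<lambda>(\<epsilon>, N). real N + real N powr (real p / (real p + 1)) * inverse \<epsilon>)"
    by (auto simp: soft_bigtheta_def intro: soft_bigomega_trans)
next
  obtain \<tau> where \<tau>: "\<tau> \<in> choices_of_order (\<lambda>N. real N powr (1 / (real p + 1)))"
    using choices_of_order_powr_nonempty[of "1 / (real p + 1)"] by auto
  \<comment> \<open>At the boundary value \<open>q = 1 / (p + 1)\<close> the exponent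
    \<open>1 - q\<close> is that of the lower bound, which is therefore attained.\<close>
  have "1 - 1 / (real p + 1) = real p / (real p + 1)" by (simp add: field_simps)
  then have "(\<lambda>x. cost p (fst x, snd x, \<tau> (fst x) (snd x)))
      \<in> \<Theta>[eps_N](\<lambda>(\<epsilon>, N). real N + real N powr (real p / (real p + 1)) * inverse \<epsilon>)"
    using cost_bigtheta_small[OF \<tau>, of p] by (simp add: add.commute)
  moreover have "\<tau> \<in> choices" using \<tau> by (simp add: choices_of_order_def)
  ultimately show "\<exists>\<tau>\<in>choices. rate_of C \<tau> \<in> soft_bigtheta eps_N
      (\<lambda>(\<epsilon>, N). real N + real N powr (real p / (real p + 1)) * inverse \<epsilon>)"
    using rate_of_soft_bigtheta[OF C] soft_bigtheta_trans by blast
qed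

theorem corollary3p18:
  fixes E J :: "real \<Rightarrow> nat \<Rightarrow> nat \<Rightarrow> real"
  assumes E: "(\<lambda>(\<epsilon>, N, \<tau>). E \<epsilon> N \<tau>) \<in> soft_bigtheta eps_N_unif
      (\<lambda>(\<epsilon>, N, \<tau>). real N + real \<tau> ^ 5 + real N * inverse \<epsilon> * inverse (real \<tau>) + inverse \<epsilon> * real \<tau> ^ 4)"
    and J: "(\<lambda>(\<epsilon>, N, \<tau>). J \<epsilon> N \<tau>) \<in> soft_bigtheta eps_N_unif
      (\<lambda>(\<epsilon>, N, \<tau>). real N + real \<tau> ^ 3 + real N * inverse \<epsilon> * inverse (real \<tau>) + inverse \<epsilon> * real \<tau> ^ 2)"
  shows
    "(is_minimal_rate E (\<lambda>(\<epsilon>, N). real N + real N powr (4/5) * inverse \<epsilon>) \<and>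
      choices_of_order (\<lambda>N. real N powr (1/5)) \<noteq> {} \<and>
      (\<forall>\<tau>\<in>choices_of_order (\<lambda>N. real N powr (1/5)).
         rate_of E \<tau> \<in> soft_bigtheta eps_N (\<lambda>(\<epsilon>, N). real N + real N powr (4/5) * inverse \<epsilon>) \<and>
         rate_of J \<tau> \<in> soft_bigtheta eps_N (\<lambda>(\<epsilon>, N). real N + real N powr (4/5) * inverse \<epsilon>))) \<and>
     (is_minimal_rate J (\<lambda>(\<epsilon>, N). real N + real N powr (2/3) * inverse \<epsilon>) \<and>
      choices_of_order (\<lambda>N. real N powr (1/3)) \<noteq> {} \<and>
      (\<forall>\<tau>\<in>choices_of_order (\<lambda>N. real N powr (1/3)).
         rate_of J \<tau> \<in> soft_bigtheta eps_N (\<lambda>(\<epsilon>, N). real N + real N powr (2/3) * inverse \<epsilon>) \<and>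
         rate_of E \<tau> \<in> soft_bigtheta eps_N (\<lambda>(\<epsilon>, N). real N powr (5/3) + real N powr (4/3) * inverse \<epsilon>)))"
proof -
  have E': "(\<lambda>(\<epsilon>, N, \<tau>). E \<epsilon> N \<tau>) \<in> soft_bigtheta eps_N_unif (cost 4)"
    and J': "(\<lambda>(\<epsilon>, N, \<tau>). J \<epsilon> N \<tau>) \<in> soft_bigtheta eps_N_unif (cost 2)"
    using E J by (simp_all add: cost_def)
  have rate: "rate_of C \<tau> \<in> soft_bigtheta eps_N R"
    if "(\<lambda>(\<epsilon>, N, \<tau>). C \<epsilon> N \<tau>) \<in> soft_bigtheta eps_N_unif (cost p)" "\<tau> \<in> choices_of_order s"
      "(\<lambda>x. cost p (fst x, snd x, \<tau> (fst x) (snd x))) \<in> \<Theta>[eps_N](R)" for C p \<tau> s R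
    using soft_bigtheta_trans[OF rate_of_soft_bigtheta[OF that(1)] that(3)] that(2)
    by (simp add: choices_of_order_def)
  show ?thesis
  proof (intro conjI ballI)
    show "is_minimal_rate E (\<lambda>(\<epsilon>, N). real N + real N powr (4/5) * inverse \<epsilon>)"
      using is_minimal_rate_of_cost[OF E'] by simp
    show "is_minimal_rate J (\<lambda>(\<epsilon>, N). real N + real N powr (2/3) * inverse \<epsilon>)"
      using is_minimal_rate_of_cost[OF J'] by simp
    show "choices_of_order (\<lambda>N. real N powr (1/5)) \<noteq> {}"
      "choices_of_order (\<lambda>N. real N powr (1/3)) \<noteq> {}"
      by (simp_all add: choices_of_order_powr_nonempty)
  next
    fix \<tau> assume \<tau>: "\<tau> \<in> choices_of_order (\<lambda>N. real N powr (1/5))"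
    show "rate_of E \<tau> \<in> soft_bigtheta eps_N (\<lambda>(\<epsilon>, N). real N + real N powr (4/5) * inverse \<epsilon>)"
      using rate[OF E' \<tau> cost_bigtheta_small[OF \<tau>]] by simp
    show "rate_of J \<tau> \<in> soft_bigtheta eps_N (\<lambda>(\<epsilon>, N). real N + real N powr (4/5) * inverse \<epsilon>)"
      \<comment> \<open>Here \<open>q * (p + 1) = 3/5 < 1\<close>: this \<tau> is below the balance
        point of \<open>J\<close>, and the exponent \<open>1 - q = 4/5\<close> does not involve
        \<open>p\<close>, hence the same rate as for \<open>E\<close>.\<close>
      using rate[OF J' \<tau> cost_bigtheta_small[OF \<tau>]] by simp
  next
    fix \<tau> assume \<tau>: "\<tau> \<in> choices_of_order (\<lambda>N. real N powr (1/3))"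
    show "rate_of J \<tau> \<in> soft_bigtheta eps_N (\<lambda>(\<epsilon>, N). real N + real N powr (2/3) * inverse \<epsilon>)"
      using rate[OF J' \<tau> cost_bigtheta_small[OF \<tau>]] by simp
    show "rate_of E \<tau> \<in> soft_bigtheta eps_N
        (\<lambda>(\<epsilon>, N). real N powr (5/3) + real N powr (4/3) * inverse \<epsilon>)"
      \<comment> \<open>Here \<open>q * (p + 1) = 5/3 > 1\<close>: this \<tau> is above the balance
        point of \<open>E\<close>, so \<open>\<tau> ^ 5\<close> and
        \<open>\<tau> ^ 4 / \<epsilon>\<close> give the exponents 5/3 and 4/3.\<close>
      using rate[OF E' \<tau> cost_bigtheta_large[OF \<tau>]] by simp
  qed
qed

end
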